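(* Fix $q\in(0,1/2)$. There are an integer $m$ and an all-null random vector $P=(P_1,\ldots,P_m)$ of $p$-values such that each $P_i$ is uniform on $(0,1)$, the joint density of $P$ is strictly positive on $(0,1)^m$, and $P$ is PRDS, but the mirror threshold at nominal level $q$ has FDR greater than $q$. The coordinates of $P$ are almost surely distinct.
   Context: "All-null" means every hypothesis is a true null, i.e. $\mathcal H_0=\{1,\ldots,m\}$. A vector $P$ is PRDS (positive regression dependence on the subset of nulls) if, for every coordinatewise increasing measurable set $D$ and every null index $i$, the map $u\mapsto\mathbb P(P\in D\mid P_i=u)$ is nondecreasing. For $p$-values $P_1,\ldots,P_m$ and $0<u\le1/2$, put $R(u)=\#\{i:P_i\le u\}$, $L(u)=\#\{i:P_i\ge1-u\}$, $\mathcal U=\{\min(P_i,1-P_i):1\le i\le m\}\cap(0,1/2]$. The mirror threshold at level $q$ is $$\widehat u=\max\Big\{u\in\mathcal U:\frac{1+L(u)}{R(u)\vee1}\le q\Big\},$$ with $\widehat u=0$ if the set is empty; the rejection set is $\widehat{\mathcal R}=\{i:P_i\le\widehat u\}$. Here $a\vee b=\max\{a,b\}$, and $\mathrm{FDR}=\mathbb E\{|\widehat{\mathcal R}\cap\mathcal H_0|/(|\widehat{\mathcal R}|\vee1)\}$. *)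

theory Defs
  imports "HOL-Probability.Probability"
begin

definition pvec :: "nat \<Rightarrow> (nat \<Rightarrow> 'a \<Rightarrow> real) \<Rightarrow> 'a \<Rightarrow> nat \<Rightarrow> real" where
  "pvec m P \<omega> = (\<lambda>i\<in>{1..m}. P i \<omega>)"

definition increasing_set :: "nat \<Rightarrow> (nat \<Rightarrow> real) set \<Rightarrow> bool" where
  "increasing_set m D \<longleftrightarrow>
     (\<forall>x\<in>D. \<forall>y\<in>space (PiM {1..m} (\<lambda>_. borel :: real measure)).
        (\<forall>i\<in>{1..m}. x i \<le> y i) \<longrightarrow> y \<in> D)"

text \<open>
  The map \<open>u \<mapsto> \<P>(P \<in> D | P\<^sub>i = u)\<close> is determined only up to a null set of the law of \<open>P\<^sub>i\<close>;
  being nondecreasing therefore means having a nondecreasing version \<open>g\<close>, i.e. one with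
  \<open>\<P>(P \<in> D | P\<^sub>i) = g(P\<^sub>i)\<close> almost surely.  Since conditional probabilities lie in \<open>[0,1]\<close>,
  a version monotone on an interval carrying \<open>P\<^sub>i\<close> extends to one monotone on the whole line.
\<close>

definition prds :: "'a measure \<Rightarrow> nat \<Rightarrow> nat set \<Rightarrow> (nat \<Rightarrow> 'a \<Rightarrow> real) \<Rightarrow> bool" where
  "prds M m H0 P \<longleftrightarrow>
     (\<forall>i\<in>{1..m}. P i \<in> borel_measurable M) \<and>
     (\<forall>D\<in>sets (PiM {1..m} (\<lambda>_. borel)). increasing_set m D \<longrightarrow>
        (\<forall>i\<in>H0. \<exists>g::real \<Rightarrow> real. mono g \<and>
           (AE \<omega> in M. real_cond_exp M (vimage_algebra (space M) (P i) borel)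
                          (\<lambda>\<omega>. indicator D (pvec m P \<omega>)) \<omega> = g (P i \<omega>))))"

definition low_count :: "nat \<Rightarrow> (nat \<Rightarrow> real) \<Rightarrow> real \<Rightarrow> nat" where
  "low_count m p u = card {i\<in>{1..m}. p i \<le> u}"

definition high_count :: "nat \<Rightarrow> (nat \<Rightarrow> real) \<Rightarrow> real \<Rightarrow> nat" where
  "high_count m p u = card {i\<in>{1..m}. p i \<ge> 1 - u}"

definition mirror_grid :: "nat \<Rightarrow> (nat \<Rightarrow> real) \<Rightarrow> real set" where
  "mirror_grid m p = {min (p i) (1 - p i) | i. i \<in> {1..m}} \<inter> {0<..1/2}"

definition mirror_admissible :: "nat \<Rightarrow> real \<Rightarrow> (nat \<Rightarrow> real) \<Rightarrow> real set" where
  "mirror_admissible m q p =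
     {u \<in> mirror_grid m p.
        (1 + real (high_count m p u)) / real (max (low_count m p u) 1) \<le> q}"

definition mirror_threshold :: "nat \<Rightarrow> real \<Rightarrow> (nat \<Rightarrow> real) \<Rightarrow> real" where
  "mirror_threshold m q p =
     (if mirror_admissible m q p = {} then 0 else Max (mirror_admissible m q p))"

definition mirror_rejections :: "nat \<Rightarrow> real \<Rightarrow> (nat \<Rightarrow> real) \<Rightarrow> nat set" where
  "mirror_rejections m q p = {i\<in>{1..m}. p i \<le> mirror_threshold m q p}"

definition mirror_fdr ::
    "'a measure \<Rightarrow> nat \<Rightarrow> nat set \<Rightarrow> (nat \<Rightarrow> 'a \<Rightarrow> real) \<Rightarrow> real \<Rightarrow> real" where
  "mirror_fdr M m H0 P q =
     (LINT \<omega>|M. real (card (mirror_rejections m q (pvec m P \<omega>) \<inter> H0)) /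
                 real (max (card (mirror_rejections m q (pvec m P \<omega>))) 1))"

end

theory Submission
  imports Defs
begin

text \<open>
  A fair coin chooses between two product laws: under one, every coordinate falls in the lower half
  of \<open>(0,1)\<close> with probability \<open>s\<close>, under the other with probability \<open>1 - s\<close>, and it is uniform
  within each half.  The two one-dimensional densities add up to \<open>2\<close>, so the marginals of the
  mixture are uniform.  For \<open>s \<ge> 1/2\<close> the second law is stochastically larger and its posterior
  weight given \<open>P\<^sub>i = u\<close> increases in \<open>u\<close>, which gives PRDS.  For \<open>s\<close> close to \<open>1\<close> all coordinates
  are below \<open>1/2\<close> with probability at least \<open>s ^ m / 2 > q\<close>; then the mirror count at the largest
  coordinate is \<open>0\<close>, and everything is rejected once \<open>1 / m \<le> q\<close>.  As all hypotheses are null, the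
  FDR is the probability of making any rejection.
\<close>

section \<open>Densities of finite product measures\<close>

text \<open>A product of sigma-finite measures is determined by its values on boxes, and over a box
  the integral of a product of one-variable functions factors.\<close>

lemma PiM_density:
  fixes f :: "'a \<Rightarrow> ennreal"
  assumes I: "finite I" and N: "sigma_finite_measure N" and [measurable]: "f \<in> borel_measurable N"
    and d: "sigma_finite_measure (density N f)"
  shows "PiM I (\<lambda>_. density N f) = density (PiM I (\<lambda>_. N)) (\<lambda>x. \<Prod>i\<in>I. f (x i))"
proof -
  interpret N: product_sigma_finite "\<lambda>_. N" using N by (rule product_sigma_finite.intro)
  interpret D: product_sigma_finite "\<lambda>_. density N f" using d by (rule product_sigma_finite.intro)
  show ?thesis
  proof (rule D.PiM_eqI[symmetric, OF I])
    show "sets (density (PiM I (\<lambda>_. N)) (\<lambda>x. \<Prod>i\<in>I. f (x i))) = sets (PiM I (\<lambda>_. density N f))"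
      by (simp cong: sets_PiM_cong)
    fix A assume "\<And>i. i \<in> I \<Longrightarrow> A i \<in> sets (density N f)"
    then have A: "\<And>i. i \<in> I \<Longrightarrow> A i \<in> sets N" by simp
    have ind: "(\<Prod>i\<in>I. indicator (A i) (x i)) = (indicator (PiE I A) x :: ennreal)"
      if "x \<in> space (PiM I (\<lambda>_. N))" for x
      using that I by (auto simp: indicator_def space_PiM PiE_iff)
    have "emeasure (density (PiM I (\<lambda>_. N)) (\<lambda>x. \<Prod>i\<in>I. f (x i))) (PiE I A)
        = (\<integral>\<^sup>+x. (\<Prod>i\<in>I. f (x i)) * indicator (PiE I A) x \<partial>PiM I (\<lambda>_. N))"
      using A I by (intro emeasure_density) (auto intro!: sets_PiM_I_finite)
    also have "\<dots> = (\<integral>\<^sup>+x. (\<Prod>i\<in>I. f (x i) * indicator (A i) (x i)) \<partial>PiM I (\<lambda>_. N))"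
      by (intro nn_integral_cong) (simp add: prod.distrib ind)
    also have "\<dots> = (\<Prod>i\<in>I. emeasure (density N f) (A i))"
      using A I by (subst N.product_nn_integral_prod) (auto simp: emeasure_density)
    finally show "emeasure (density (PiM I (\<lambda>_. N)) (\<lambda>x. \<Prod>i\<in>I. f (x i))) (PiE I A)
        = (\<Prod>i\<in>I. emeasure (density N f) (A i))" .
  qed
qed

section \<open>The tilted laws on the unit interval\<close>

text \<open>The parameter \<open>c\<close> is the mass of the lower half. The point 1/2 is counted
  with the upper half, so that for 0 < c < 1 the density is positive at every point of (0,1), not
  just almost everywhere.\<close>

definition tilt_density :: "real \<Rightarrow> real \<Rightarrow> real" where
  "tilt_density c u =
     (if 0 < u \<and> u < 1/2 then 2 * c else if 1/2 \<le> u \<and> u < 1 then 2 * (1 - c) else 0)"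

definition tilt :: "real \<Rightarrow> real measure" where
  "tilt c = density lborel (\<lambda>u. ennreal (tilt_density c u))"

lemma borel_measurable_tilt_density [measurable]: "tilt_density c \<in> borel_measurable borel"
  unfolding tilt_density_def by measurable

lemma tilt_density_nonneg: "0 \<le> c \<Longrightarrow> c \<le> 1 \<Longrightarrow> 0 \<le> tilt_density c u"
  by (simp add: tilt_density_def)

lemma sets_tilt [simp, measurable_cong]: "sets (tilt c) = sets borel"
  by (simp add: tilt_def)

lemma space_tilt [simp]: "space (tilt c) = UNIV"
  by (simp add: tilt_def)

lemma nn_integral_tilt:
  "h \<in> borel_measurable borel \<Longrightarrow>
    (\<integral>\<^sup>+u. h u \<partial>tilt c) = (\<integral>\<^sup>+u. ennreal (tilt_density c u) * h u \<partial>lborel)"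
  unfolding tilt_def by (subst nn_integral_density) auto

lemma ennreal_mult_inverse_2: "0 \<le> a \<Longrightarrow> ennreal a * inverse 2 = ennreal (a / 2)"
  using ennreal_divide_numeral[of a "num.Bit0 num.One"] by (simp add: divide_ennreal_def)

lemma emeasure_tilt_half:
  assumes "0 \<le> c" "c \<le> 1"
  shows "emeasure (tilt c) {0<..<1/2} = ennreal c"
proof -
  have "emeasure (tilt c) {0<..<1/2} = (\<integral>\<^sup>+u. ennreal (2 * c) * indicator {0<..<1/2::real} u \<partial>lborel)"
    unfolding tilt_def
    by (subst emeasure_density) (auto intro!: nn_integral_cong simp: tilt_density_def indicator_def)
  also have "\<dots> = ennreal c"
    using assms by (simp add: nn_integral_cmult ennreal_mult_inverse_2 diff_divide_distrib)
  finally show ?thesis .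
qed

lemma prob_space_tilt:
  assumes "0 \<le> c" "c \<le> 1"
  shows "prob_space (tilt c)"
proof
  have "emeasure (tilt c) (space (tilt c))
      = (\<integral>\<^sup>+u. ennreal (2 * c) * indicator {0<..<1/2::real} u
              + ennreal (2 * (1 - c)) * indicator {1/2..<1::real} u \<partial>lborel)"
    unfolding tilt_def
    by (subst emeasure_density) (auto intro!: nn_integral_cong simp: tilt_density_def indicator_def)
  also have "\<dots> = ennreal c + ennreal (1 - c)"
    using assms by (simp add: nn_integral_add nn_integral_cmult ennreal_mult_inverse_2 diff_divide_distrib)
  also have "\<dots> = 1"
    using assms by (simp add: ennreal_plus[symmetric] del: ennreal_plus)
  finally show "emeasure (tilt c) (space (tilt c)) = 1" .
qed

text \<open>Stochastic monotonicity in the tilt: the difference of the two densities changes sign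
  once, at 1/2, so its product with \<open>h u - h (1/2)\<close> has constant sign. The constant
  \<open>h (1/2)\<close> contributes nothing to the integral of this product, as both densities have
  mass 1.\<close>

lemma nn_integral_tilt_antimono:
  fixes h :: "real \<Rightarrow> ennreal"
  assumes c: "0 \<le> c'" "c' \<le> c" "c \<le> 1" and h: "mono h" and b: "\<And>u. h u \<le> 1"
    and [measurable]: "h \<in> borel_measurable borel"
  shows "(\<integral>\<^sup>+u. h u \<partial>tilt c) \<le> (\<integral>\<^sup>+u. h u \<partial>tilt c')"
proof -
  let ?d = "\<lambda>c u. ennreal (tilt_density c u)"
  have one: "(\<integral>\<^sup>+u. ?d c u \<partial>lborel) = 1" if "0 \<le> c" "c \<le> 1" for c
    using prob_space.emeasure_space_1[OF prob_space_tilt[OF that]]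
    by (simp add: tilt_def emeasure_density)
  \<comment> \<open>Every term stands on the side where its sign is positive, because subtraction in
    \<open>ennreal\<close> is truncated.\<close>
  have pw: "?d c u * h u + ?d c' u * h (1/2) \<le> ?d c' u * h u + ?d c u * h (1/2)" for u
  proof -
    \<comment> \<open>The bound by 1 makes \<open>h\<close> finite, so the inequality can be checked
      in the reals.\<close>
    have hr: "h v = ennreal (enn2real (h v))" for v
      using b[of v] by (metis ennreal_enn2real ennreal_one_less_top order_le_less_trans)
    have mono_enn2real: "enn2real (h v) \<le> enn2real (h w)" if "v \<le> w" for v w
      using h that hr b by (meson enn2real_mono ennreal_one_less_top monoD order_le_less_trans)
    \<comment> \<open>Since \<open>c' \<le> c\<close>, the first factor is nonpositive below 1/2 and
      nonnegative from 1/2 on; the second has the same sign pattern by monotonicity of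
      \<open>h\<close>.\<close>
    have "0 \<le> (tilt_density c' u - tilt_density c u) * (enn2real (h u) - enn2real (h (1/2)))"
      using mono_enn2real[of u "1/2"] mono_enn2real[of "1/2" u] c
      by (auto simp: tilt_density_def mult_nonpos_nonpos)
    then have "tilt_density c u * enn2real (h u) + tilt_density c' u * enn2real (h (1/2))
        \<le> tilt_density c' u * enn2real (h u) + tilt_density c u * enn2real (h (1/2))"
      by (simp add: algebra_simps)
    then show ?thesis
      using c by (subst (1 2 3 4) hr)
        (simp add: tilt_density_nonneg ennreal_mult[symmetric] ennreal_plus[symmetric] del: ennreal_plus)
  qed
  have "(\<integral>\<^sup>+u. h u \<partial>tilt c) + h (1/2)
      = (\<integral>\<^sup>+u. ?d c u * h u + ?d c' u * h (1/2) \<partial>lborel)"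
    using c by (simp add: nn_integral_add nn_integral_multc one nn_integral_tilt)
  also have "\<dots> \<le> (\<integral>\<^sup>+u. ?d c' u * h u + ?d c u * h (1/2) \<partial>lborel)"
    by (intro nn_integral_mono pw)
  also have "\<dots> = (\<integral>\<^sup>+u. h u \<partial>tilt c') + h (1/2)"
    using c by (simp add: nn_integral_add nn_integral_multc one nn_integral_tilt)
  finally have "(\<integral>\<^sup>+u. h u \<partial>tilt c) + h (1/2) \<le> (\<integral>\<^sup>+u. h u \<partial>tilt c') + h (1/2)" .
  moreover have "h (1/2) < top" using b[of "1/2"] by (simp add: order_le_less_trans)
  ultimately show ?thesis by (metis add.commute ennreal_add_left_cancel_le less_irrefl infinity_ennreal_def)
qed

section \<open>Product laws and their stochastic order\<close>

abbreviation tilt_power :: "real \<Rightarrow> 'i set \<Rightarrow> ('i \<Rightarrow> real) measure" where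
  "tilt_power c I \<equiv> PiM I (\<lambda>_. tilt c)"

lemma sets_tilt_power: "sets (tilt_power c I) = sets (PiM I (\<lambda>_. borel))"
  by (intro sets_PiM_cong) auto

lemma space_tilt_power: "space (tilt_power c I) = PiE I (\<lambda>_. UNIV)"
  by (simp add: space_PiM)

lemma prob_space_tilt_power: "0 \<le> c \<Longrightarrow> c \<le> 1 \<Longrightarrow> prob_space (tilt_power c I)"
  by (intro prob_space_PiM prob_space_tilt)

lemma product_sigma_finite_tilt:
  "0 \<le> c \<Longrightarrow> c \<le> 1 \<Longrightarrow> product_sigma_finite (\<lambda>_. tilt c)"
  by (intro product_sigma_finite.intro prob_space_imp_sigma_finite prob_space_tilt)

text \<open>Coordinates are switched from \<open>c\<close> to \<open>c'\<close> one at a time, each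
  switch being an instance of the one-dimensional comparison
  \<open>nn_integral_tilt_antimono\<close>.\<close>

lemma nn_integral_tilt_power_antimono:
  fixes F :: "('i \<Rightarrow> real) \<Rightarrow> ennreal"
  assumes c: "0 \<le> c'" "c' \<le> c" "c \<le> 1" and "finite J"
    and "F \<in> borel_measurable (PiM J (\<lambda>_. borel))" and "\<And>x. F x \<le> 1"
    and "\<And>x y. x \<in> PiE J (\<lambda>_. UNIV) \<Longrightarrow> y \<in> PiE J (\<lambda>_. UNIV) \<Longrightarrow>
           (\<And>i. i \<in> J \<Longrightarrow> x i \<le> y i) \<Longrightarrow> F x \<le> F y"
  shows "(\<integral>\<^sup>+x. F x \<partial>tilt_power c J) \<le> (\<integral>\<^sup>+x. F x \<partial>tilt_power c' J)"
  using assms(4-)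
proof (induction J arbitrary: F rule: finite_induct)
  case empty
  then show ?case by (simp add: PiM_empty)
next
  case (insert j J)
  note [measurable] = insert.prems(1)
  note mono = insert.prems(3)
  interpret c: product_sigma_finite "\<lambda>_::'i. tilt c" using c by (intro product_sigma_finite_tilt) auto
  interpret c': product_sigma_finite "\<lambda>_::'i. tilt c'" using c by (intro product_sigma_finite_tilt) auto
  interpret t: prob_space "tilt c'" using c by (intro prob_space_tilt) auto
  \<comment> \<open>\<open>H\<close> integrates out the new coordinate under the target law
    \<open>c'\<close>. It inherits measurability, the bound 1 and monotonicity from
    \<open>F\<close>, so the induction hypothesis applies to it; hence the generalization over
    \<open>F\<close>.\<close>
  define H where "H x = (\<integral>\<^sup>+y. F (x(j := y)) \<partial>tilt c')" for x
  have up: "(\<lambda>(x, y). x(j := y)) \<in> measurable (PiM J (\<lambda>_. borel) \<Otimes>\<^sub>M borel) (PiM (insert j J) (\<lambda>_. borel :: real measure))"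
    by (rule measurable_add_dim)
  have "(\<lambda>(x, y). F (x(j := y))) \<in> borel_measurable (PiM J (\<lambda>_. borel) \<Otimes>\<^sub>M borel)"
    using measurable_compose[OF up insert.prems(1)] by (simp add: split_beta')
  then have [measurable]: "(\<lambda>(x, y). F (x(j := y))) \<in> borel_measurable (PiM J (\<lambda>_. borel) \<Otimes>\<^sub>M tilt c')"
    by (simp cong: measurable_cong_sets sets_pair_measure_cong)
  have H[measurable]: "H \<in> borel_measurable (PiM J (\<lambda>_. borel))"
    unfolding H_def by (rule sigma_finite_measure.borel_measurable_nn_integral) (unfold_locales, measurable)
  have F': "F \<in> borel_measurable (tilt_power d (insert j J))" for d
    using insert.prems(1) by (simp add: sets_tilt_power cong: measurable_cong_sets)
  have "(\<integral>\<^sup>+x. F x \<partial>tilt_power c (insert j J)) = (\<integral>\<^sup>+x. \<integral>\<^sup>+y. F (x(j := y)) \<partial>tilt c \<partial>tilt_power c J)"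
    using insert F' by (intro c.product_nn_integral_insert) auto
  also have "\<dots> \<le> (\<integral>\<^sup>+x. H x \<partial>tilt_power c J)"
    unfolding H_def
  proof (intro nn_integral_mono nn_integral_tilt_antimono c insert.prems(2))
    fix x :: "'i \<Rightarrow> real" assume x: "x \<in> space (tilt_power c J)"
    show "mono (\<lambda>y. F (x(j := y)))"
      using x by (intro monoI mono) (auto simp: space_PiM PiE_iff extensional_def)
    have "(\<lambda>y. x(j := y)) \<in> measurable borel (PiM (insert j J) (\<lambda>_. borel))"
      using measurable_compose[OF measurable_Pair1'[of x "PiM J (\<lambda>_. borel)" borel] up] x
      by (simp add: space_PiM)
    then show "(\<lambda>y. F (x(j := y))) \<in> borel_measurable borel"
      by measurable
  qed
  also have "\<dots> \<le> (\<integral>\<^sup>+x. H x \<partial>tilt_power c' J)"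
  proof (rule insert.IH[OF H])
    show "H x \<le> 1" for x
      unfolding H_def
      using nn_integral_mono[of "tilt c'" "\<lambda>y. F (x(j := y))" "\<lambda>_. 1"] insert.prems(2) t.emeasure_space_1
      by simp
    fix x y :: "'i \<Rightarrow> real"
    assume "x \<in> PiE J (\<lambda>_. UNIV)" "y \<in> PiE J (\<lambda>_. UNIV)" "\<And>i. i \<in> J \<Longrightarrow> x i \<le> y i"
    then show "H x \<le> H y"
      unfolding H_def
      by (intro nn_integral_mono mono) (auto simp: PiE_iff extensional_def)
  qed
  also have "\<dots> = (\<integral>\<^sup>+x. F x \<partial>tilt_power c' (insert j J))"
    unfolding H_def using insert F' by (intro c'.product_nn_integral_insert[symmetric]) auto
  finally show ?case .
qed

section \<open>The mixture of the two product laws\<close>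

definition tilt_mix_density :: "real \<Rightarrow> 'i set \<Rightarrow> ('i \<Rightarrow> real) \<Rightarrow> real" where
  "tilt_mix_density s I x =
     ((\<Prod>i\<in>I. tilt_density s (x i)) + (\<Prod>i\<in>I. tilt_density (1 - s) (x i))) / 2"

text \<open>Defining the mixture by its Lebesgue density makes the joint density required by the
  theorem immediate; \<open>nn_integral_tilt_mix\<close> recovers the average of the two product
  laws.\<close>

definition tilt_mix :: "real \<Rightarrow> 'i set \<Rightarrow> ('i \<Rightarrow> real) measure" where
  "tilt_mix s I = density (PiM I (\<lambda>_. lborel)) (\<lambda>x. ennreal (tilt_mix_density s I x))"

lemma borel_measurable_tilt_mix_density [measurable]:
  "tilt_mix_density s I \<in> borel_measurable (PiM I (\<lambda>_. lborel))"
  unfolding tilt_mix_density_def by measurable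

lemma tilt_mix_density_pos:
  assumes "0 < s" "s < 1" "x \<in> PiE I (\<lambda>_. {0<..<1})"
  shows "0 < tilt_mix_density s I x"
proof -
  have "0 < tilt_density c (x i)" if "i \<in> I" "0 < c" "c < 1" for i c
    using that PiE_mem[OF assms(3), of i] by (auto simp: tilt_density_def)
  then show ?thesis
    using assms by (auto simp: tilt_mix_density_def intro!: add_pos_pos prod_pos)
qed

lemma sets_tilt_mix [measurable_cong]: "sets (tilt_mix s I) = sets (PiM I (\<lambda>_. borel))"
  by (simp add: tilt_mix_def cong: sets_PiM_cong)

lemma measurable_tilt_mix: "measurable (tilt_mix s I) N = measurable (PiM I (\<lambda>_. borel)) N"
  by (intro measurable_cong_sets sets_tilt_mix refl)

lemma measurable_component_tilt_mix: "i \<in> I \<Longrightarrow> (\<lambda>x. x i) \<in> borel_measurable (tilt_mix s I)"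
  unfolding measurable_tilt_mix by (rule measurable_component_singleton)

lemma space_tilt_mix: "space (tilt_mix s I) = PiE I (\<lambda>_. UNIV)"
  by (simp add: tilt_mix_def space_PiM)

text \<open>By \<open>PiM_density\<close> both product laws have Lebesgue densities, and these sum
  to twice the mixture density. The factor 2 on the left avoids division in
  \<open>ennreal\<close>.\<close>

lemma nn_integral_tilt_mix:
  assumes s: "0 \<le> s" "s \<le> 1" and I: "finite I"
    and F: "F \<in> borel_measurable (PiM I (\<lambda>_. borel))"
  shows "2 * (\<integral>\<^sup>+x. F x \<partial>tilt_mix s I) = (\<integral>\<^sup>+x. F x \<partial>tilt_power s I) + (\<integral>\<^sup>+x. F x \<partial>tilt_power (1 - s) I)"
proof -
  let ?L = "PiM I (\<lambda>_. lborel :: real measure)"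
  let ?p = "\<lambda>c x. \<Prod>i\<in>I. ennreal (tilt_density c (x i))"
  have FL [measurable]: "F \<in> borel_measurable ?L"
    using F by (simp cong: measurable_cong_sets sets_PiM_cong)
  have T: "(\<integral>\<^sup>+x. F x \<partial>tilt_power c I) = (\<integral>\<^sup>+x. ?p c x * F x \<partial>?L)" if "0 \<le> c" "c \<le> 1" for c
  proof -
    have "tilt_power c I = density ?L (?p c)"
      using I prob_space_imp_sigma_finite[OF prob_space_tilt[OF that]] unfolding tilt_def
      by (intro PiM_density) (auto intro: sigma_finite_lborel)
    then show ?thesis by (simp add: nn_integral_density)
  qed
  have two: "2 * ennreal (tilt_mix_density s I x) = ?p s x + ?p (1 - s) x" for x
  proof -
    have nn: "0 \<le> (\<Prod>i\<in>I. tilt_density c (x i))" if "0 \<le> c" "c \<le> 1" for c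
      using that by (intro prod_nonneg) (simp add: tilt_density_nonneg)
    have "2 * ennreal (tilt_mix_density s I x) = ennreal (2 * tilt_mix_density s I x)"
      by (simp add: ennreal_mult')
    also have "\<dots> = ennreal (\<Prod>i\<in>I. tilt_density s (x i)) + ennreal (\<Prod>i\<in>I. tilt_density (1 - s) (x i))"
      using s nn[of s] nn[of "1 - s"] by (simp add: tilt_mix_density_def add_divide_distrib)
    also have "\<dots> = ?p s x + ?p (1 - s) x"
      using s by (simp add: prod_ennreal tilt_density_nonneg)
    finally show ?thesis .
  qed
  have "2 * (\<integral>\<^sup>+x. F x \<partial>tilt_mix s I) = (\<integral>\<^sup>+x. 2 * (ennreal (tilt_mix_density s I x) * F x) \<partial>?L)"
    by (simp add: tilt_mix_def nn_integral_density nn_integral_cmult)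
  also have "\<dots> = (\<integral>\<^sup>+x. ?p s x * F x + ?p (1 - s) x * F x \<partial>?L)"
    by (intro nn_integral_cong) (simp add: two mult.assoc[symmetric] distrib_right)
  also have "\<dots> = (\<integral>\<^sup>+x. F x \<partial>tilt_power s I) + (\<integral>\<^sup>+x. F x \<partial>tilt_power (1 - s) I)"
    using s by (simp add: nn_integral_add T)
  finally show ?thesis .
qed

lemma ennreal_mult_2_cancel: "2 * (a :: ennreal) = 2 * b \<Longrightarrow> a = b"
  by (subst (asm) ennreal_mult_cancel_left) auto

lemma prob_space_tilt_mix:
  fixes I :: "'i set"
  assumes s: "0 \<le> s" "s \<le> 1" and I: "finite I"
  shows "prob_space (tilt_mix s I)"
proof
  interpret t1: prob_space "tilt_power s I" using s by (intro prob_space_tilt_power) auto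
  interpret t2: prob_space "tilt_power (1 - s) I" using s by (intro prob_space_tilt_power) auto
  have "2 * emeasure (tilt_mix s I) (space (tilt_mix s I)) = 2 * 1"
    using nn_integral_tilt_mix[OF s I, of "\<lambda>_. 1"] t1.emeasure_space_1 t2.emeasure_space_1
    by simp
  then show "emeasure (tilt_mix s I) (space (tilt_mix s I)) = 1"
    by (rule ennreal_mult_2_cancel)
qed

section \<open>Uniform marginals\<close>

text \<open>Bayes' formula for one coordinate: on (0,1) each tilt density is twice the posterior
  weight of its component. Taking \<open>h = k\<close> gives the marginals, since the weights sum to
  1; taking different functions gives the conditional probabilities.\<close>

lemma nn_integral_tilt_tilt:
  assumes s: "0 \<le> s" "s \<le> 1" and [measurable]: "h \<in> borel_measurable borel" "k \<in> borel_measurable borel"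
  shows "(\<integral>\<^sup>+u. h u \<partial>tilt s) + (\<integral>\<^sup>+u. k u \<partial>tilt (1 - s))
       = 2 * (\<integral>\<^sup>+u. ennreal (if u < 1/2 then s else 1 - s) * h u
             + ennreal (if u < 1/2 then 1 - s else s) * k u \<partial>uniform_measure lborel {0<..<1})"
proof -
  let ?w = "\<lambda>u. ennreal (if u < 1/2 then s else 1 - s) * h u
             + ennreal (if u < 1/2 then 1 - s else s) * k u"
  have "(\<integral>\<^sup>+u. h u \<partial>tilt s) + (\<integral>\<^sup>+u. k u \<partial>tilt (1 - s))
      = (\<integral>\<^sup>+u. ennreal (tilt_density s u) * h u + ennreal (tilt_density (1 - s) u) * k u \<partial>lborel)"
    by (simp add: nn_integral_tilt nn_integral_add)
  also have "\<dots> = (\<integral>\<^sup>+u. 2 * (?w u * indicator {0<..<1} u) \<partial>lborel)"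
    using s by (intro nn_integral_cong)
      (auto simp: tilt_density_def ennreal_mult' distrib_left mult.assoc indicator_def simp del: right_diff_distrib_numeral)
  also have "\<dots> = 2 * (\<integral>\<^sup>+u. ?w u \<partial>uniform_measure lborel {0<..<1})"
    by (simp add: nn_integral_cmult nn_integral_uniform_measure divide_ennreal_def)
  finally show ?thesis .
qed

lemma nn_integral_tilt_power_component:
  assumes c: "0 \<le> c" "c \<le> 1" and "i \<in> I" and "h \<in> borel_measurable borel"
  shows "(\<integral>\<^sup>+x. h (x i) \<partial>tilt_power c I) = (\<integral>\<^sup>+u. h u \<partial>tilt c)"
proof -
  have "(\<integral>\<^sup>+u. h u \<partial>tilt c) = (\<integral>\<^sup>+u. h u \<partial>distr (tilt_power c I) (tilt c) (\<lambda>x. x i))"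
    using assms by (subst distr_PiM_component) (auto intro: prob_space_tilt)
  also have "\<dots> = (\<integral>\<^sup>+x. h (x i) \<partial>tilt_power c I)"
    using assms by (intro nn_integral_distr) auto
  finally show ?thesis by simp
qed

lemma nn_integral_tilt_mix_component:
  assumes s: "0 \<le> s" "s \<le> 1" and I: "finite I" "i \<in> I" and [measurable]: "h \<in> borel_measurable borel"
  shows "(\<integral>\<^sup>+x. h (x i) \<partial>tilt_mix s I) = (\<integral>\<^sup>+u. h u \<partial>uniform_measure lborel {0<..<1})"
proof (rule ennreal_mult_2_cancel)
  have "2 * (\<integral>\<^sup>+x. h (x i) \<partial>tilt_mix s I) = (\<integral>\<^sup>+x. h (x i) \<partial>tilt_power s I) + (\<integral>\<^sup>+x. h (x i) \<partial>tilt_power (1 - s) I)"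
    using I by (intro nn_integral_tilt_mix s) measurable
  also have "\<dots> = (\<integral>\<^sup>+u. h u \<partial>tilt s) + (\<integral>\<^sup>+u. h u \<partial>tilt (1 - s))"
    using s I by (simp add: nn_integral_tilt_power_component)
  also have "\<dots> = 2 * (\<integral>\<^sup>+u. h u \<partial>uniform_measure lborel {0<..<1})"
    using s by (subst nn_integral_tilt_tilt)
      (auto simp: distrib_right[symmetric] ennreal_plus[symmetric] simp del: ennreal_plus
        intro!: arg_cong[where f = "(*) 2"] nn_integral_cong)
  finally show "2 * (\<integral>\<^sup>+x. h (x i) \<partial>tilt_mix s I) = 2 * (\<integral>\<^sup>+u. h u \<partial>uniform_measure lborel {0<..<1})" .
qed

lemma distr_tilt_mix_component:
  assumes s: "0 \<le> s" "s \<le> 1" and I: "finite I" "i \<in> I"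
  shows "distr (tilt_mix s I) lborel (\<lambda>x. x i) = uniform_measure lborel {0<..<1}"
proof (rule measure_eqI)
  have [measurable]: "(\<lambda>x. x i) \<in> measurable (tilt_mix s I) lborel"
    using measurable_component_tilt_mix[OF I(2)] by simp
  fix A assume "A \<in> sets (distr (tilt_mix s I) lborel (\<lambda>x. x i))"
  then have [measurable]: "A \<in> sets borel" by simp
  have "emeasure (distr (tilt_mix s I) lborel (\<lambda>x. x i)) A
      = (\<integral>\<^sup>+u. indicator A u \<partial>distr (tilt_mix s I) lborel (\<lambda>x. x i))"
    by simp
  also have "\<dots> = (\<integral>\<^sup>+x. indicator A (x i) \<partial>tilt_mix s I)"
    by (intro nn_integral_distr) (auto intro: measurable_component_tilt_mix I)
  also have "\<dots> = emeasure (uniform_measure lborel {0<..<1}) A"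
    using s I by (subst nn_integral_tilt_mix_component) auto
  finally show "emeasure (distr (tilt_mix s I) lborel (\<lambda>x. x i)) A
      = emeasure (uniform_measure lborel {0<..<1}) A" .
qed simp

section \<open>Almost sure distinctness of the coordinates\<close>

text \<open>Integrate over coordinate \<open>i\<close> first: with the others fixed, the diagonal
  meets this line in the single point \<open>x j\<close>, which is Lebesgue null.\<close>

lemma AE_PiM_lborel_distinct:
  fixes I :: "'i set"
  assumes I: "finite I" "i \<in> I" "j \<in> I" "i \<noteq> j"
  shows "AE x in PiM I (\<lambda>_. lborel :: real measure). x i \<noteq> x j"
proof -
  let ?L = "\<lambda>I. PiM I (\<lambda>_::'i. lborel :: real measure)"
  interpret product_sigma_finite "\<lambda>_::'i. lborel :: real measure"
    by (intro product_sigma_finite.intro sigma_finite_lborel)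
  have [measurable]: "{x \<in> space (?L I). x i = x j} \<in> sets (?L I)"
    using I by measurable
  have J: "insert i (I - {i}) = I" using I by auto
  have "emeasure (?L I) {x \<in> space (?L I). x i = x j}
      = (\<integral>\<^sup>+x. indicator {x \<in> space (?L I). x i = x j} x \<partial>?L (insert i (I - {i})))"
    by (subst J) simp
  also have "\<dots> = (\<integral>\<^sup>+x. \<integral>\<^sup>+y. indicator {x \<in> space (?L I). x i = x j} (x(i := y)) \<partial>lborel \<partial>?L (I - {i}))"
    using I by (intro product_nn_integral_insert) (auto simp: insert_absorb)
  also have "\<dots> \<le> (\<integral>\<^sup>+x. \<integral>\<^sup>+y. indicator {x j} y \<partial>lborel \<partial>?L (I - {i}))"
    using I by (intro nn_integral_mono) (auto simp: indicator_def)
  also have "\<dots> = 0" by simp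
  finally have "emeasure (?L I) {x \<in> space (?L I). x i = x j} = 0" by simp
  then show ?thesis
    by (intro AE_I[of _ _ "{x \<in> space (?L I). x i = x j}"]) auto
qed

text \<open>The mixture is absolutely continuous, so it inherits the null sets of the Lebesgue
  product; there are only finitely many pairs of coordinates.\<close>

lemma AE_tilt_mix_inj_on:
  assumes I: "finite I"
  shows "AE x in tilt_mix s I. inj_on (\<lambda>i. x i) I"
proof -
  have "AE x in PiM I (\<lambda>_. lborel :: real measure). \<forall>i\<in>I. \<forall>j\<in>I. i \<noteq> j \<longrightarrow> x i \<noteq> x j"
    using I by (intro AE_finite_allI) (auto intro: AE_PiM_lborel_distinct)
  then show ?thesis
    unfolding tilt_mix_def by (subst AE_density) (auto elim!: eventually_mono simp: inj_on_def)
qed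

section \<open>Conditional probabilities of increasing sets given one coordinate\<close>

text \<open>With \<open>J = I - {i}\<close> this is the conditional probability of \<open>D\<close>
  given \<open>x i = u\<close> under the product law \<open>tilt_power c I\<close>, because there
  the coordinates are independent.\<close>

definition section_prob :: "real \<Rightarrow> 'i set \<Rightarrow> ('i \<Rightarrow> real) set \<Rightarrow> 'i \<Rightarrow> real \<Rightarrow> real" where
  "section_prob c J D i u = measure (tilt_power c J) {x \<in> PiE J (\<lambda>_. UNIV). x(i := u) \<in> D}"

context
  fixes I :: "'i set" and i :: 'i and D :: "('i \<Rightarrow> real) set"
  assumes I: "finite I" "i \<in> I"
    and D: "D \<in> sets (PiM I (\<lambda>_. borel))"
    and incr: "\<And>x y. x \<in> D \<Longrightarrow> y \<in> PiE I (\<lambda>_. UNIV) \<Longrightarrow> (\<And>j. j \<in> I \<Longrightarrow> x j \<le> y j) \<Longrightarrow> y \<in> D"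
begin

lemma measurable_section:
  "{x \<in> PiE (I - {i}) (\<lambda>_. UNIV). x(i := u) \<in> D} \<in> sets (PiM (I - {i}) (\<lambda>_. borel))"
proof -
  have "(\<lambda>x. x(i := u)) \<in> measurable (PiM (I - {i}) (\<lambda>_. borel)) (PiM I (\<lambda>_. borel))"
    using I by (intro measurable_fun_upd[where J = "I - {i}"]) auto
  from measurable_sets[OF this D] show ?thesis
    by (simp add: space_PiM vimage_def Int_def conj_commute)
qed

lemma ennreal_section_prob:
  assumes "0 \<le> c" "c \<le> 1"
  shows "ennreal (section_prob c (I - {i}) D i u) = (\<integral>\<^sup>+x. indicator D (x(i := u)) \<partial>tilt_power c (I - {i}))"
proof -
  interpret prob_space "tilt_power c (I - {i})" using assms by (rule prob_space_tilt_power)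
  have "ennreal (section_prob c (I - {i}) D i u)
      = (\<integral>\<^sup>+x. indicator {x \<in> PiE (I - {i}) (\<lambda>_. UNIV). x(i := u) \<in> D} x \<partial>tilt_power c (I - {i}))"
    using measurable_section[of u]
    by (simp add: section_prob_def emeasure_eq_measure sets_tilt_power)
  also have "\<dots> = (\<integral>\<^sup>+x. indicator D (x(i := u)) \<partial>tilt_power c (I - {i}))"
    by (intro nn_integral_cong) (auto simp: indicator_def space_tilt_power)
  finally show ?thesis .
qed

lemma section_prob_range:
  assumes "0 \<le> c" "c \<le> 1"
  shows "0 \<le> section_prob c (I - {i}) D i u" "section_prob c (I - {i}) D i u \<le> 1"
proof -
  interpret prob_space "tilt_power c (I - {i})" using assms by (rule prob_space_tilt_power)
  show "0 \<le> section_prob c (I - {i}) D i u" "section_prob c (I - {i}) D i u \<le> 1"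
    by (auto simp: section_prob_def)
qed

text \<open>As \<open>D\<close> is closed upwards, its sections grow with the fixed
  coordinate.\<close>

lemma mono_section_prob:
  assumes c: "0 \<le> c" "c \<le> 1"
  shows "mono (section_prob c (I - {i}) D i)"
proof
  fix u v :: real assume uv: "u \<le> v"
  interpret prob_space "tilt_power c (I - {i})" using c by (rule prob_space_tilt_power)
  have "x(i := v) \<in> D" if x: "x \<in> PiE (I - {i}) (\<lambda>_. UNIV)" "x(i := u) \<in> D" for x
    using x uv I by (intro incr[OF x(2)]) (auto simp: PiE_iff extensional_def)
  then show "section_prob c (I - {i}) D i u \<le> section_prob c (I - {i}) D i v"
    unfolding section_prob_def using measurable_section[of v]
    by (intro finite_measure_mono) (auto simp: sets_tilt_power)
qed

text \<open>The section of \<open>D\<close> is itself increasing in the remaining coordinates, so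
  the comparison of product laws applies to its indicator.\<close>

lemma section_prob_antimono:
  assumes c: "0 \<le> c'" "c' \<le> c" "c \<le> 1"
  shows "section_prob c (I - {i}) D i u \<le> section_prob c' (I - {i}) D i u"
proof -
  let ?S = "{x \<in> PiE (I - {i}) (\<lambda>_. UNIV). x(i := u) \<in> D}"
  interpret c: prob_space "tilt_power c (I - {i})" using c by (intro prob_space_tilt_power) auto
  interpret c': prob_space "tilt_power c' (I - {i})" using c by (intro prob_space_tilt_power) auto
  have "x \<in> ?S \<Longrightarrow> y \<in> ?S"
    if "x \<in> PiE (I - {i}) (\<lambda>_. UNIV)" "y \<in> PiE (I - {i}) (\<lambda>_. UNIV)" "\<And>j. j \<in> I - {i} \<Longrightarrow> x j \<le> y j" for x y
    using that I incr[of "x(i := u)" "y(i := u)"] by (auto simp: PiE_iff extensional_def)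
  then have "(\<integral>\<^sup>+x. indicator ?S x \<partial>tilt_power c (I - {i})) \<le> (\<integral>\<^sup>+x. indicator ?S x \<partial>tilt_power c' (I - {i}))"
    using measurable_section[of u] I
    by (intro nn_integral_tilt_power_antimono c) (auto simp del: indicator_simps intro!: borel_measurable_indicator split: split_indicator)
  then show ?thesis
    using measurable_section[of u]
    by (simp add: section_prob_def sets_tilt_power c.emeasure_eq_measure c'.emeasure_eq_measure)
qed

text \<open>The weights are the posterior probabilities of the two mixture components given \<open>x i = u\<close>.\<close>

definition cond_prob :: "real \<Rightarrow> real \<Rightarrow> real" where
  "cond_prob s u = (if u < 1/2 then s else 1 - s) * section_prob s (I - {i}) D i u
                 + (if u < 1/2 then 1 - s else s) * section_prob (1 - s) (I - {i}) D i u"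

lemma cond_prob_range:
  assumes "0 \<le> s" "s \<le> 1"
  shows "0 \<le> cond_prob s u" "cond_prob s u \<le> 1"
proof -
  show "0 \<le> cond_prob s u"
    using assms by (simp add: cond_prob_def section_prob_range)
  show "cond_prob s u \<le> 1"
    using assms section_prob_range[of s u] section_prob_range[of "1 - s" u]
    unfolding cond_prob_def by (intro convex_bound_le) auto
qed

text \<open>Two effects point the same way: both section probabilities increase in \<open>u\<close>,
  and the posterior weight moves to the component under which \<open>D\<close> is more likely. The
  bound \<open>1/2 \<le> s\<close> gives the direction of both the weight shift and the comparison
  of components.\<close>

lemma mono_cond_prob:
  assumes s: "1/2 \<le> s" "s \<le> 1"
  shows "mono (cond_prob s)"
proof
  fix u v :: real assume uv: "u \<le> v"
  let ?w = "\<lambda>u::real. if u < 1/2 then s else 1 - s"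
  let ?G = "section_prob s (I - {i}) D i" and ?H = "section_prob (1 - s) (I - {i}) D i"
  have w: "?w v \<le> ?w u" "0 \<le> ?w u" "?w u \<le> 1" using uv s by auto
  have eq: "cond_prob s t = ?H t - ?w t * (?H t - ?G t)" for t
    by (simp add: cond_prob_def algebra_simps)
  have GH: "?G v \<le> ?H v" using s by (intro section_prob_antimono) auto
  have G: "?G u \<le> ?G v" using monoD[OF mono_section_prob[of s] uv] s by simp
  have H: "?H u \<le> ?H v" using monoD[OF mono_section_prob[of "1 - s"] uv] s by simp
  have "cond_prob s u = ?w u * ?G u + (1 - ?w u) * ?H u"
    by (simp add: cond_prob_def)
  \<comment> \<open>First the argument moves from \<open>u\<close> to \<open>v\<close> with the
    weights frozen.\<close>
  also have "\<dots> \<le> ?w u * ?G v + (1 - ?w u) * ?H v"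
    using w G H by (intro add_mono mult_left_mono) auto
  also have "\<dots> = ?H v - ?w u * (?H v - ?G v)" by (simp add: algebra_simps)
  \<comment> \<open>Then the weight drops; its coefficient \<open>?H v - ?G v\<close> is
    nonnegative.\<close>
  also have "\<dots> \<le> ?H v - ?w v * (?H v - ?G v)"
    using w GH by (intro diff_left_mono mult_right_mono) auto
  also have "\<dots> = cond_prob s v" by (simp add: eq)
  finally show "cond_prob s u \<le> cond_prob s v" .
qed

text \<open>This is the defining identity of conditional probability on the event that
  \<open>x i\<close> lies in \<open>B\<close>. Each product law is integrated over the other
  coordinates, Bayes' formula combines the two results over the uniform law, and the uniform
  marginal leads back to the mixture.\<close>

lemma nn_integral_cond_prob:
  assumes s: "1/2 \<le> s" "s \<le> 1" and B [measurable]: "B \<in> sets borel"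
  shows "(\<integral>\<^sup>+x. indicator D x * indicator B (x i) \<partial>tilt_mix s I)
       = (\<integral>\<^sup>+x. ennreal (cond_prob s (x i)) * indicator B (x i) \<partial>tilt_mix s I)"
proof (rule ennreal_mult_2_cancel)
  have insert_i: "insert i (I - {i}) = I" using I by auto
  have s': "0 \<le> s" "0 \<le> 1 - s" "1 - s \<le> 1" using s by auto
  have [measurable]: "D \<in> sets (PiM I (\<lambda>_. borel))" by (rule D)
  have [measurable]: "section_prob c (I - {i}) D i \<in> borel_measurable borel" if "0 \<le> c" "c \<le> 1" for c
    using that by (intro borel_measurable_mono mono_section_prob)
  have [measurable]: "cond_prob s \<in> borel_measurable borel"
    using s by (intro borel_measurable_mono mono_cond_prob)
  let ?F = "\<lambda>x. indicator D x * indicator B (x i) :: ennreal"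
  have F [measurable]: "?F \<in> borel_measurable (PiM I (\<lambda>_. borel))"
    using I by measurable
  have T: "(\<integral>\<^sup>+x. ?F x \<partial>tilt_power c I) = (\<integral>\<^sup>+u. ennreal (section_prob c (I - {i}) D i u) * indicator B u \<partial>tilt c)"
    if c: "0 \<le> c" "c \<le> 1" for c
  proof -
    interpret product_sigma_finite "\<lambda>_::'i. tilt c" using c by (rule product_sigma_finite_tilt)
    have F': "?F \<in> borel_measurable (tilt_power c (insert i (I - {i})))"
      using F unfolding insert_i by (simp add: sets_tilt_power cong: measurable_cong_sets)
    have "(\<integral>\<^sup>+x. ?F x \<partial>tilt_power c I) = (\<integral>\<^sup>+x. ?F x \<partial>tilt_power c (insert i (I - {i})))"
      by (subst insert_i) simp
    \<comment> \<open>Coordinate \<open>i\<close> is kept outermost, so the inner integral is a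
      section probability times the constant \<open>indicator B u\<close>.\<close>
    also have "\<dots> = (\<integral>\<^sup>+u. \<integral>\<^sup>+x. ?F (x(i := u)) \<partial>tilt_power c (I - {i}) \<partial>tilt c)"
      using I F' by (intro product_nn_integral_insert_rev) auto
    also have "\<dots> = (\<integral>\<^sup>+u. ennreal (section_prob c (I - {i}) D i u) * indicator B u \<partial>tilt c)"
    proof (intro nn_integral_cong)
      fix u
      have "(\<lambda>x. indicator D (x(i := u)) :: ennreal) \<in> borel_measurable (tilt_power c (I - {i}))"
      proof -
        have "(\<lambda>x. x(i := u)) \<in> measurable (PiM (I - {i}) (\<lambda>_. borel)) (PiM I (\<lambda>_. borel))"
          using I by (intro measurable_fun_upd[where J = "I - {i}"]) auto
        then have "(\<lambda>x. indicator D (x(i := u)) :: ennreal) \<in> borel_measurable (PiM (I - {i}) (\<lambda>_. borel))"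
          by measurable
        then show ?thesis by (simp add: sets_tilt_power cong: measurable_cong_sets)
      qed
      then show "(\<integral>\<^sup>+x. ?F (x(i := u)) \<partial>tilt_power c (I - {i})) = ennreal (section_prob c (I - {i}) D i u) * indicator B u"
        using c by (simp add: ennreal_section_prob nn_integral_multc)
    qed
    finally show ?thesis .
  qed
  have "2 * (\<integral>\<^sup>+x. ?F x \<partial>tilt_mix s I) = (\<integral>\<^sup>+x. ?F x \<partial>tilt_power s I) + (\<integral>\<^sup>+x. ?F x \<partial>tilt_power (1 - s) I)"
    using s s' I F by (intro nn_integral_tilt_mix) auto
  also have "\<dots> = (\<integral>\<^sup>+u. ennreal (section_prob s (I - {i}) D i u) * indicator B u \<partial>tilt s)
      + (\<integral>\<^sup>+u. ennreal (section_prob (1 - s) (I - {i}) D i u) * indicator B u \<partial>tilt (1 - s))"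
    using s s' by (simp add: T)
  also have "\<dots> = 2 * (\<integral>\<^sup>+u. ennreal (cond_prob s u) * indicator B u \<partial>uniform_measure lborel {0<..<1})"
    using s s'
    by (subst nn_integral_tilt_tilt)
      (auto simp: cond_prob_def section_prob_range ennreal_mult' distrib_right mult.assoc
        intro!: arg_cong[where f = "(*) 2"] nn_integral_cong)
  also have "\<dots> = 2 * (\<integral>\<^sup>+x. ennreal (cond_prob s (x i)) * indicator B (x i) \<partial>tilt_mix s I)"
    using s s' I
    by (subst nn_integral_tilt_mix_component[where h = "\<lambda>u. ennreal (cond_prob s u) * indicator B u"]) auto
  finally show "2 * (\<integral>\<^sup>+x. ?F x \<partial>tilt_mix s I)
      = 2 * (\<integral>\<^sup>+x. ennreal (cond_prob s (x i)) * indicator B (x i) \<partial>tilt_mix s I)" .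
qed

section \<open>The PRDS property of the mixture\<close>

text \<open>Every event generated by \<open>x i\<close> is a preimage of a Borel set, so
  \<open>nn_integral_cond_prob\<close> checks all that characterizes the conditional expectation.
  The restriction to \<open>I\<close> matches \<open>pvec\<close> and is the identity on the space
  of \<open>M\<close>.\<close>

lemma real_cond_exp_tilt_mix:
  assumes s: "1/2 \<le> s" "s \<le> 1"
  defines "M \<equiv> tilt_mix s I"
  shows "AE x in M. real_cond_exp M (vimage_algebra (space M) (\<lambda>x. x i) borel)
             (\<lambda>x. indicator D (restrict x I)) x = cond_prob s (x i)"
proof -
  let ?F = "vimage_algebra (space M) (\<lambda>x. x i) borel"
  interpret prob_space M unfolding M_def using s I by (intro prob_space_tilt_mix) auto
  have proj [measurable]: "(\<lambda>x. x i) \<in> borel_measurable M"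
    using I by (simp add: M_def measurable_component_tilt_mix)
  have sub: "subalgebra M ?F"
    unfolding subalgebra_def
    using measurable_sets[OF proj] by (auto simp: sets_vimage_algebra2)
  interpret finite_measure_subalgebra M ?F
    by unfold_locales (rule sub)
  have [measurable]: "D \<in> sets M" using D by (simp add: M_def sets_tilt_mix)
  have c [measurable]: "cond_prob s \<in> borel_measurable borel"
    using s by (intro borel_measurable_mono mono_cond_prob)
  have s0: "0 \<le> s" using s by simp
  note range = cond_prob_range[OF s0 s(2)]
  have restr: "restrict x I = x" if "x \<in> space M" for x
    using that by (auto simp: M_def space_tilt_mix PiE_iff extensional_restrict)
  show ?thesis
  proof (rule real_cond_exp_charact)
    fix A assume "A \<in> sets ?F"
    then obtain B where B [measurable]: "B \<in> sets borel" and A: "A = (\<lambda>x. x i) -` B \<inter> space M"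
      by (auto simp: sets_vimage_algebra2)
    have ind: "indicator A x = (indicator B (x i) :: real)" if "x \<in> space M" for x
      using that by (auto simp: A indicator_def)
    have "(\<integral>x\<in>A. (indicator D (restrict x I) :: real) \<partial>M) = (\<integral>x. indicator D x * indicator B (x i) \<partial>M)"
      unfolding set_lebesgue_integral_def by (intro Bochner_Integration.integral_cong) (auto simp: ind restr mult.commute)
    \<comment> \<open>Detour through nonnegative integrals, where the identity was proved.\<close>
    also have "\<dots> = enn2real (\<integral>\<^sup>+x. indicator D x * indicator B (x i) \<partial>M)"
      by (subst integral_eq_nn_integral) (auto simp: ennreal_mult' ennreal_indicator)
    also have "\<dots> = enn2real (\<integral>\<^sup>+x. ennreal (cond_prob s (x i)) * indicator B (x i) \<partial>M)"
      unfolding M_def by (simp only: nn_integral_cond_prob[OF s B])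
    also have "\<dots> = (\<integral>x. cond_prob s (x i) * indicator B (x i) \<partial>M)"
      using range by (subst integral_eq_nn_integral) (auto simp: ennreal_mult' ennreal_indicator)
    also have "\<dots> = (\<integral>x\<in>A. cond_prob s (x i) \<partial>M)"
      unfolding set_lebesgue_integral_def by (intro Bochner_Integration.integral_cong) (auto simp: ind mult.commute)
    finally show "(\<integral>x\<in>A. (indicator D (restrict x I) :: real) \<partial>M) = (\<integral>x\<in>A. cond_prob s (x i) \<partial>M)" .
  next
    have "integrable M (\<lambda>x. indicator D x :: real)"
      by (intro integrable_real_indicator) (auto simp: emeasure_eq_measure)
    then show "integrable M (\<lambda>x. indicator D (restrict x I) :: real)"
      by (rule Bochner_Integration.integrable_cong[THEN iffD2, rotated 2]) (auto simp: restr)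
    show "integrable M (\<lambda>x. cond_prob s (x i))"
      using range by (intro integrable_const_bound[of _ 1]) auto
    have "(\<lambda>x. x i) \<in> measurable ?F borel" by (rule measurable_vimage_algebra1) auto
    then show "(\<lambda>x. cond_prob s (x i)) \<in> borel_measurable ?F" by measurable
  qed
qed

end

lemma prds_tilt_mix:
  assumes s: "1/2 \<le> s" "s \<le> 1"
  shows "prds (tilt_mix s {1..m}) m {1..m} (\<lambda>i x. x i)"
  unfolding prds_def
proof (intro conjI ballI impI)
  let ?M = "tilt_mix s {1..m}"
  fix i assume i: "i \<in> {1..m}"
  show "(\<lambda>x. x i) \<in> borel_measurable ?M"
    using i by (rule measurable_component_tilt_mix)
next
  let ?M = "tilt_mix s {1..m}"
  fix D and i assume D: "D \<in> sets (PiM {1..m} (\<lambda>_. borel))" "increasing_set m D" and i: "i \<in> {1..m}"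
  have incr: "y \<in> D" if "x \<in> D" "y \<in> PiE {1..m} (\<lambda>_. UNIV)" "\<And>j. j \<in> {1..m} \<Longrightarrow> x j \<le> y j" for x y
    using D(2) that unfolding increasing_set_def by (force simp: space_PiM)
  let ?h = "\<lambda>x. indicator D (pvec m (\<lambda>i x. x i) x) :: real"
  have "AE x in ?M. real_cond_exp ?M (vimage_algebra (space ?M) (\<lambda>x. x i) borel) ?h x = cond_prob {1..m} i D s (x i)"
    unfolding pvec_def by (rule real_cond_exp_tilt_mix[OF finite_atLeastAtMost i D(1) _ s]) (rule incr)
  moreover have "mono (cond_prob {1..m} i D s)"
    by (rule mono_cond_prob[OF finite_atLeastAtMost i D(1) _ s]) (rule incr)
  ultimately show "\<exists>g. mono g \<and> (AE x in ?M. real_cond_exp ?M (vimage_algebra (space ?M) (\<lambda>x. x i) borel) ?h x = g (x i))"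
    by (intro exI conjI)
qed

section \<open>The mirror procedure\<close>

lemma finite_mirror_admissible: "finite (mirror_admissible m q p)"
  unfolding mirror_admissible_def mirror_grid_def by simp

text \<open>Replaces the maximum in the threshold by a finite disjunction, which serves both for
  exhibiting a rejection and for measurability. The disjunct \<open>p i \<le> 0\<close> covers the
  default threshold 0.\<close>

lemma mirror_rejections_nonempty_iff:
  assumes "q < 1"
  shows "mirror_rejections m q p \<noteq> {} \<longleftrightarrow>
    (\<exists>i\<in>{1..m}. min (p i) (1 - p i) \<in> mirror_admissible m q p) \<or> (\<exists>i\<in>{1..m}. p i \<le> 0)"
proof (cases "mirror_admissible m q p = {}")
  case True
  then show ?thesis by (auto simp: mirror_rejections_def mirror_threshold_def)
next
  case False
  let ?t = "mirror_threshold m q p"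
  have t: "?t \<in> mirror_admissible m q p"
    using False Max_in[OF finite_mirror_admissible False] by (simp add: mirror_threshold_def)
  \<comment> \<open>With no coordinate at or below the threshold the denominator would be 1 and the
    ratio at least 1, which exceeds \<open>q\<close>.\<close>
  have "low_count m p ?t \<noteq> 0"
  proof
    assume "low_count m p ?t = 0"
    then have "1 + real (high_count m p ?t) \<le> q"
      using t by (simp add: mirror_admissible_def)
    then show False using assms by linarith
  qed
  then have "mirror_rejections m q p \<noteq> {}"
    unfolding low_count_def mirror_rejections_def by (metis card.empty)
  moreover have "\<exists>i\<in>{1..m}. min (p i) (1 - p i) \<in> mirror_admissible m q p"
    using t by (auto simp: mirror_admissible_def mirror_grid_def)
  ultimately show ?thesis by simp
qed

lemma mirror_rejections_nonempty_if_low: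
  assumes q: "0 < q" "q < 1" "1 / q \<le> real m" and p: "\<And>i. i \<in> {1..m} \<Longrightarrow> 0 < p i \<and> p i < 1/2"
  shows "mirror_rejections m q p \<noteq> {}"
proof -
  have "0 < 1 / q" using q by simp
  then have m: "1 \<le> m" using q by (cases m) auto
  \<comment> \<open>The largest coordinate has all \<open>m\<close> coordinates at or below it, and
    its mirror image lies above 1/2, where there are none; the ratio is thus
    \<open>1 / m\<close>.\<close>
  let ?u = "Max (p ` {1..m})"
  have "?u \<in> p ` {1..m}" using m by (intro Max_in) auto
  then obtain i where i: "i \<in> {1..m}" "?u = p i" by auto
  have "p j \<le> p i" if "j \<in> {1..m}" for j
    unfolding i(2)[symmetric] using that by (intro Max_ge) auto
  then have low: "{j \<in> {1..m}. p j \<le> p i} = {1..m}" by auto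
  have "\<not> p j \<ge> 1 - p i" if "j \<in> {1..m}" for j
    using p[OF i(1)] p[OF that] by linarith
  then have high: "{j \<in> {1..m}. p j \<ge> 1 - p i} = {}" by blast
  have counts: "low_count m p (p i) = m" "high_count m p (p i) = 0"
    unfolding low_count_def high_count_def low high by simp_all
  have "min (p i) (1 - p i) = p i" using p[OF i(1)] by simp
  moreover have "p i \<in> mirror_grid m p"
    using p[OF i(1)] i(1) by (auto simp: mirror_grid_def intro!: exI[of _ i])
  ultimately have "min (p i) (1 - p i) \<in> mirror_admissible m q p"
    using q m by (simp add: mirror_admissible_def counts field_simps)
  then show ?thesis using i(1) q by (subst mirror_rejections_nonempty_iff) auto
qed

text \<open>When every hypothesis is null, all rejections are false, so the false discovery
  proportion is 0 or 1.\<close>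

lemma mirror_fdp_all_null:
  "real (card (mirror_rejections m q p \<inter> {1..m})) / real (max (card (mirror_rejections m q p)) 1)
     = (if mirror_rejections m q p \<noteq> {} then 1 else 0)"
proof -
  have sub: "mirror_rejections m q p \<subseteq> {1..m}" by (auto simp: mirror_rejections_def)
  then have "finite (mirror_rejections m q p)" by (rule finite_subset) simp
  then have "mirror_rejections m q p \<noteq> {} \<Longrightarrow> 1 \<le> card (mirror_rejections m q p)"
    by (simp add: Suc_le_eq card_gt_0_iff)
  then show ?thesis
    by (cases "mirror_rejections m q p = {}") (simp_all only: Int_absorb2[OF sub] max_absorb1, auto)
qed

text \<open>Needed for integrability of the rejection indicator: a Bochner integral of a
  non-integrable function is 0 by convention, and no lower bound could be read off.\<close>

lemma measurable_mirror_rejections_nonempty: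
  assumes "q < 1"
  shows "Measurable.pred (PiM {1..m} (\<lambda>_. borel)) (\<lambda>x. mirror_rejections m q x \<noteq> {})"
proof -
  let ?B = "PiM {1..m} (\<lambda>_. borel :: real measure)"
  have comp [measurable]: "(\<lambda>x. x j) \<in> borel_measurable ?B" if "j \<in> {1..m}" for j
    using that by (rule measurable_component_singleton)
  \<comment> \<open>Counts become finite sums of indicators, measurable term by term.\<close>
  have count: "real (card {j \<in> {1..m}. Q j}) = (\<Sum>j\<in>{1..m}. if Q j then 1 else 0)" for Q :: "nat \<Rightarrow> bool"
    by (simp add: sum.If_cases Int_def)
  have "Measurable.pred ?B (\<lambda>x. min (x i) (1 - x i) \<in> mirror_admissible m q x)" if i [measurable]: "i \<in> {1..m}" for i
  proof -
    have [measurable]: "(\<lambda>x. x i) \<in> borel_measurable ?B" by (rule comp[OF i])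
    have [measurable]: "(\<lambda>x. real (low_count m x (min (x i) (1 - x i)))) \<in> borel_measurable ?B"
      unfolding low_count_def count
    proof (intro borel_measurable_sum)
      fix j assume "j \<in> {1..m}"
      note [measurable] = comp[OF this]
      show "(\<lambda>x. if x j \<le> min (x i) (1 - x i) then 1 else 0 :: real) \<in> borel_measurable ?B"
        by measurable
    qed
    have [measurable]: "(\<lambda>x. real (high_count m x (min (x i) (1 - x i)))) \<in> borel_measurable ?B"
      unfolding high_count_def count
    proof (intro borel_measurable_sum)
      fix j assume "j \<in> {1..m}"
      note [measurable] = comp[OF this]
      show "(\<lambda>x. if 1 - min (x i) (1 - x i) \<le> x j then 1 else 0 :: real) \<in> borel_measurable ?B"
        by measurable
    qed
    \<comment> \<open>The index \<open>i\<close> itself witnesses grid membership, leaving only the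
      range condition and the ratio.\<close>
    have "(min (x i) (1 - x i) \<in> mirror_admissible m q x) \<longleftrightarrow>
        0 < min (x i) (1 - x i) \<and> min (x i) (1 - x i) \<le> 1/2 \<and>
        (1 + real (high_count m x (min (x i) (1 - x i)))) / max (real (low_count m x (min (x i) (1 - x i)))) 1 \<le> q"
      for x
      using i by (auto simp: mirror_admissible_def mirror_grid_def of_nat_max)
    then show ?thesis by (simp only:) measurable
  qed
  then show ?thesis
    unfolding mirror_rejections_nonempty_iff[OF assms] by measurable
qed

section \<open>The lower bound for the false discovery rate\<close>

lemma emeasure_tilt_power_low:
  assumes "0 \<le> c" "c \<le> 1" "finite I"
  shows "emeasure (tilt_power c I) (PiE I (\<lambda>_. {0<..<1/2})) = ennreal (c ^ card I)"
proof -
  interpret product_sigma_finite "\<lambda>_. tilt c" using assms by (intro product_sigma_finite_tilt)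
  show ?thesis
    using assms by (simp add: emeasure_PiM emeasure_tilt_half ennreal_power)
qed

lemma measure_tilt_mix_low:
  assumes s: "0 \<le> s" "s \<le> 1" and I: "finite I"
  shows "s ^ card I / 2 \<le> measure (tilt_mix s I) (PiE I (\<lambda>_. {0<..<1/2}))"
proof -
  let ?E = "PiE I (\<lambda>_. {0<..<1/2::real})"
  interpret prob_space "tilt_mix s I" using s I by (rule prob_space_tilt_mix)
  have E: "?E \<in> sets (PiM I (\<lambda>_. borel))" using I by (intro sets_PiM_I_finite) auto
  \<comment> \<open>The contribution of the component with parameter \<open>1 - s\<close> is simply
    dropped.\<close>
  have "ennreal (s ^ card I) \<le> (\<integral>\<^sup>+x. indicator ?E x \<partial>tilt_power s I) + (\<integral>\<^sup>+x. indicator ?E x \<partial>tilt_power (1 - s) I)"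
    using E s I by (simp add: sets_tilt_power emeasure_tilt_power_low)
  also have "\<dots> = 2 * (\<integral>\<^sup>+x. indicator ?E x \<partial>tilt_mix s I)"
    using E by (intro nn_integral_tilt_mix[symmetric] s I) auto
  also have "\<dots> = ennreal (2 * prob ?E)"
    using E by (simp add: sets_tilt_mix emeasure_eq_measure ennreal_mult')
  finally show ?thesis by simp
qed

text \<open>The event that all coordinates lie in (0,1/2) forces a rejection, so its indicator is a
  pointwise lower bound for the false discovery proportion.\<close>

lemma mirror_fdr_tilt_mix:
  assumes q: "0 < q" "q < 1" "1 / q \<le> real m" and s: "0 \<le> s" "s \<le> 1"
  shows "s ^ m / 2 \<le> mirror_fdr (tilt_mix s {1..m}) m {1..m} (\<lambda>i x. x i) q"
proof -
  let ?M = "tilt_mix s {1..m}" and ?E = "PiE {1..m} (\<lambda>_. {0<..<1/2::real})"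
  let ?r = "\<lambda>x. if mirror_rejections m q x \<noteq> {} then 1 else 0 :: real"
  interpret prob_space ?M using s by (intro prob_space_tilt_mix) auto
  have E [measurable]: "?E \<in> sets ?M" unfolding sets_tilt_mix by (intro sets_PiM_I_finite) auto
  have [measurable]: "Measurable.pred (PiM {1..m} (\<lambda>_. borel)) (\<lambda>x. mirror_rejections m q x \<noteq> {})"
    using q by (intro measurable_mirror_rejections_nonempty) auto
  have r: "?r \<in> borel_measurable ?M"
    unfolding measurable_tilt_mix by measurable
  have "s ^ m / 2 \<le> (LINT x|?M. indicator ?E x)"
    using measure_tilt_mix_low[OF s, of "{1..m}"] E by simp
  also have "\<dots> \<le> (LINT x|?M. ?r x)"
  proof (rule integral_mono)
    show "integrable ?M ?r" using r by (intro integrable_const_bound[of _ 1]) auto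
    show "integrable ?M (indicator ?E :: _ \<Rightarrow> real)"
      by (intro integrable_real_indicator E) (simp add: emeasure_eq_measure del: One_nat_def)
    show "indicator ?E x \<le> ?r x" for x
      using mirror_rejections_nonempty_if_low[OF q, of x] by (auto simp: indicator_def PiE_iff)
  qed
  also have "\<dots> = mirror_fdr ?M m {1..m} (\<lambda>i x. x i) q"
    unfolding mirror_fdr_def mirror_fdp_all_null
    by (intro Bochner_Integration.integral_cong refl)
      (simp add: pvec_def space_tilt_mix PiE_iff extensional_restrict)
  finally show ?thesis .
qed

section \<open>Choice of the parameters and assembly\<close>

theorem proposition4:
  fixes q :: real
  assumes "0 < q" and "q < 1/2"
  shows "\<exists>(m::nat) (M :: (nat \<Rightarrow> real) measure) (P :: nat \<Rightarrow> (nat \<Rightarrow> real) \<Rightarrow> real)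
            (f :: (nat \<Rightarrow> real) \<Rightarrow> real).
     prob_space M \<and>
     (\<forall>i\<in>{1..m}. P i \<in> borel_measurable M \<and>
        distr M lborel (P i) = uniform_measure lborel {0<..<1}) \<and>
     distributed M (PiM {1..m} (\<lambda>_. lborel)) (pvec m P) (\<lambda>x. ennreal (f x)) \<and>
     (\<forall>x\<in>PiE {1..m} (\<lambda>_. {0<..<1}). 0 < f x) \<and>
     prds M m {1..m} P \<and>
     (AE \<omega> in M. inj_on (\<lambda>i. P i \<omega>) {1..m}) \<and>
     mirror_fdr M m {1..m} P q > q"
proof -
  \<comment> \<open>The least \<open>m\<close> with \<open>1 / m \<le> q\<close>.\<close>
  define m where "m = nat \<lceil>1 / q\<rceil>"
  have mq: "1 / q \<le> real m" unfolding m_def by (rule real_nat_ceiling_ge)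
  have "0 < 1 / q" using assms by simp
  then have m: "0 < m" using mq by (cases m) auto
  \<comment> \<open>The number \<open>q + 1/2\<close> is the midpoint of \<open>2 * q\<close> and 1.
    Being below 1 it gives \<open>s < 1\<close>, hence a positive density; being above
    \<open>2 * q\<close> it gives \<open>s ^ m / 2 > q\<close>. The maximum with 1/2 secures
    PRDS.\<close>
  define s where "s = max (1/2) (root m (q + 1/2))"
  have "root m (q + 1/2) < 1"
    using m assms real_root_less_mono[of m "q + 1/2" 1] by simp
  then have s: "1/2 \<le> s" "s < 1" by (auto simp: s_def)
  have "root m (q + 1/2) ^ m \<le> s ^ m"
    using m assms by (intro power_mono) (auto simp: s_def)
  then have "q + 1/2 \<le> s ^ m" using m assms by simp
  then have sm: "q < s ^ m / 2" using assms by simp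
  let ?M = "tilt_mix s {1..m}" and ?P = "\<lambda>i x. x i :: real" and ?f = "tilt_mix_density s {1..m}"
  have pvec: "pvec m ?P x = x" if "x \<in> space ?M" for x
    using that by (simp add: pvec_def space_tilt_mix PiE_iff extensional_restrict)
  have "distributed ?M (PiM {1..m} (\<lambda>_. lborel)) (pvec m ?P) (\<lambda>x. ennreal (?f x))"
  proof -
    let ?L = "PiM {1..m} (\<lambda>_. lborel :: real measure)"
    have sets: "sets ?L = sets ?M" by (simp add: tilt_mix_def)
    have "pvec m ?P \<in> measurable ?M ?L"
      using measurable_ident_sets[OF sets[symmetric]]
      by (subst measurable_cong[OF pvec]) (auto simp: id_def)
    \<comment> \<open>On the space of the mixture \<open>pvec\<close> is the identity, so its law is
      the mixture itself, which is a density by definition.\<close>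
    moreover have "distr ?M ?L (pvec m ?P) = distr ?M ?M (\<lambda>x. x)"
      by (intro distr_cong sets pvec refl)
    ultimately show ?thesis
      unfolding distributed_def by simp (simp add: tilt_mix_def)
  qed
  moreover have "q < mirror_fdr ?M m {1..m} ?P q"
    using mirror_fdr_tilt_mix[of q m s] sm mq assms s by linarith
  moreover have "prds ?M m {1..m} ?P"
    using s by (intro prds_tilt_mix) auto
  moreover have "AE x in ?M. inj_on (\<lambda>i. ?P i x) {1..m}"
    by (rule AE_tilt_mix_inj_on) simp
  moreover have "prob_space ?M"
    using s by (intro prob_space_tilt_mix) auto
  moreover have "\<forall>i\<in>{1..m}. ?P i \<in> borel_measurable ?M \<and>
      distr ?M lborel (?P i) = uniform_measure lborel {0<..<1}"
    using s by (intro ballI conjI measurable_component_tilt_mix distr_tilt_mix_component) auto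
  moreover have "\<forall>x\<in>PiE {1..m} (\<lambda>_. {0<..<1}). 0 < ?f x"
    using s by (intro ballI tilt_mix_density_pos) auto
  ultimately show ?thesis by (intro exI conjI)
qed

end
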